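(* For a finite simple graph $G$ and an integer $\ell\ge 0$, let $\Phi_\ell(G)$ denote the number of matchings of size $\ell$ in $G$. For a set $W$ of vertices of $G$ and an integer $m\geq 0$, let \[ d_m(W)=\sum_{S\in\binom{W}{m}}\ \prod_{v\in S} d_v , \] where $d_v$ is the degree of $v$ in $G$ and $\binom{W}{m}$ is the set of $m$-element subsets of $W$. (i) Let $G$ be a bipartite graph with bipartition $X\cup Y$, nonempty vertex set and no isolated vertices, and let $\ell$ be an integer with $0\le\ell\le\min\{|X|,|Y|\}$. Set $\delta_X=\min\{d_x: x\in X\}$ and $\alpha_Y=\ell/|Y|$. Then \[ \log \Phi_\ell(G) \leq \log d_\ell(X)+|Y|\left[H(\alpha_Y)+\alpha_Y\log\frac{\alpha_Y}{e}+\frac{\log\delta_X}{\delta_X-1}\right]. \] (ii) Let $G$ be a (not necessarily bipartite) graph on a vertex set $V$ of size $N\geq 1$, with no isolated vertices and with minimum degree $\delta$, let $\ell$ be an integer with $0\le\ell\le N/2$, and set $\alpha=2\ell/N$. Then \[ \log \Phi_\ell(G) \leq \frac12\log d_{2\ell}(V)+\frac N2\left[H(\alpha)+\alpha\log\frac{\alpha}{e}+\frac{\log\delta}{\delta-1}\right]. \]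
   Context: Here $\log=\log_2$, $e$ is the base of natural logarithms, and $H$ is the binary entropy function $H(p)=-p\log p-(1-p)\log(1-p)$ for $p\in[0,1]$. Expressions of the form $0\cdot\log b$ (including $0\cdot\log 0$) are interpreted as $0$. The expression $\frac{\log x}{x-1}$ is interpreted as $\log e$ when $x=1$. If $\Phi_\ell(G)=0$, then $\log\Phi_\ell(G)$ is read as $-\infty$ and the inequality holds trivially. A matching of size $\ell$ is a set of $\ell$ pairwise disjoint edges. For $m=0$ one has $d_0(W)=1$ (empty product over the single empty subset). *)

theory Defs
  imports Complex_Main "HOL-Library.Extended_Real"
begin

locale fin_simple_graph =
  fixes V :: "'a set" and E :: "'a set set"
  assumes finite_vertices: "finite V"
    and edges: "e \<in> E \<Longrightarrow> e \<subseteq> V \<and> card e = 2"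

definition bipartition :: "'a set \<Rightarrow> 'a set set \<Rightarrow> 'a set \<Rightarrow> 'a set \<Rightarrow> bool" where
  "bipartition V E X Y \<longleftrightarrow>
     X \<union> Y = V \<and> X \<inter> Y = {} \<and> (\<forall>e\<in>E. \<exists>x\<in>X. \<exists>y\<in>Y. e = {x, y})"

definition degree :: "'a set set \<Rightarrow> 'a \<Rightarrow> nat" where
  "degree E v = card {e \<in> E. v \<in> e}"

definition no_isolated :: "'a set \<Rightarrow> 'a set set \<Rightarrow> bool" where
  "no_isolated V E \<longleftrightarrow> (\<forall>v\<in>V. \<exists>e\<in>E. v \<in> e)"

definition min_degree :: "'a set set \<Rightarrow> 'a set \<Rightarrow> nat" where
  "min_degree E W = Min (degree E ` W)"

definition matchings :: "'a set set \<Rightarrow> nat \<Rightarrow> 'a set set set" where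
  "matchings E l = {M. M \<subseteq> E \<and> card M = l \<and> pairwise disjnt M}"

definition num_matchings :: "'a set set \<Rightarrow> nat \<Rightarrow> nat" where
  "num_matchings E l = card (matchings E l)"

definition deg_sum :: "'a set set \<Rightarrow> nat \<Rightarrow> 'a set \<Rightarrow> nat" where
  "deg_sum E m W = (\<Sum>S | S \<subseteq> W \<and> card S = m. \<Prod>v\<in>S. degree E v)"

text \<open>Binary logarithm of a count, with value \<open>-\<infinity>\<close> at \<open>0\<close> (whereas \<^term>\<open>log 2 0 = (0::real)\<close>).\<close>

definition elog2 :: "nat \<Rightarrow> ereal" where
  "elog2 n = (if n = 0 then - \<infinity> else ereal (log 2 (real n)))"

text \<open>The convention \<open>0 \<cdot> log b = 0\<close> needs no case distinction, since \<^term>\<open>log 2\<close> is total.\<close>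

definition bin_entropy :: "real \<Rightarrow> real" where
  "bin_entropy p = - p * log 2 p - (1 - p) * log 2 (1 - p)"

text \<open>The quotient \<open>log x / (x - 1)\<close>, with its limit \<open>log e\<close> at \<open>x = 1\<close>.\<close>

definition log_quot :: "real \<Rightarrow> real" where
  "log_quot x = (if x = 1 then log 2 (exp 1) else log 2 x / (x - 1))"

end

theory Submission
  imports Defs "HOL-Library.FuncSet"
begin

text \<open>
  For a set \<open>S\<close> of \<open>\<ell>\<close> vertices on one side of a bipartite graph, the matchings covering exactly
  \<open>S\<close> on that side form a permanent of an \<open>\<ell> \<times> |Y|\<close> matrix. Padding this matrix with
  \<open>|Y| - \<ell>\<close> full rows and applying Bregman's theorem, the bound reduces to
  \<open>ln d! / d \<le> ln d - 1 + ln d / (d - 1)\<close> and to the monotonicity of \<open>ln d / (d - 1)\<close>; both this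
  estimate and the Stirling bound behind it come from \<open>ln x \<ge> 2 (x - 1) / (x + 1)\<close>. Summing over
  \<open>S\<close> gives (i).

  For (ii), the union of two matchings \<open>M\<close>, \<open>M'\<close> is bipartite. Orienting the edges of \<open>M\<close> from the
  first colour class to the second and those of \<open>M'\<close> the other way round, with a colouring that
  depends only on \<open>M \<union> M'\<close>, embeds pairs of \<open>\<ell>\<close>-matchings into the \<open>2\<ell>\<close>-matchings of the bipartite
  double cover, to which the argument for (i) applies.
\<close>

subsection \<open>Logarithmic estimates\<close>

text \<open>The difference of the two sides vanishes at 1 and has derivative (y - 1)^2 / (y (y +
  1)^2). The bound is exact to second order at 1, which the term ln n / 2 in the upper Stirling
  estimate requires.\<close>

lemma ln_ge_two_mult_div:
  fixes x :: real
  assumes "1 \<le> x"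
  shows "2 * (x - 1) / (x + 1) \<le> ln x"
proof -
  define f where "f = (\<lambda>x::real. ln x - 2 * (x - 1) / (x + 1))"
  have "f 1 \<le> f x"
  proof (rule DERIV_nonneg_imp_nondecreasing[OF assms])
    fix y :: real
    assume y: "1 \<le> y" "y \<le> x"
    have "(f has_real_derivative (1 / y - 4 / (y + 1)\<^sup>2)) (at y)"
      unfolding f_def using y
      by (auto intro!: derivative_eq_intros simp: field_simps power2_eq_square)
    moreover have "4 * y \<le> (y + 1)\<^sup>2"
      using zero_le_power2[of "y - 1"] by (simp add: power2_eq_square algebra_simps)
    then have "0 \<le> 1 / y - 4 / (y + 1)\<^sup>2"
      using y by (simp add: divide_simps)
    ultimately show "\<exists>z. (f has_real_derivative z) (at y) \<and> 0 \<le> z" by blast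
  qed
  then show ?thesis by (simp add: f_def)
qed

lemma ln_fact_Suc: "ln (fact (Suc n) :: real) = ln (real (Suc n)) + ln (fact n)"
  by (simp add: ln_mult del: of_nat_Suc)

text \<open>Stirling in the form n! \<le> e sqrt(n) (n/e)^n, with equality at n = 1. The induction
  step amounts to (n + 1/2) ln(1 + 1/n) \<ge> 1, which is \<open>ln_ge_two_mult_div\<close> at x = 1
  + 1/n.\<close>

lemma ln_fact_le:
  assumes "1 \<le> n"
  shows "ln (fact n :: real) \<le> 1 + ln (real n) / 2 + real n * ln (real n) - real n"
  using assms
proof (induction n rule: dec_induct)
  case (step n)
  define x where "x = 1 + 1 / real n"
  have n: "0 < real n" using step by simp
  have "2 * (x - 1) / (x + 1) \<le> ln x"
    using n by (intro ln_ge_two_mult_div) (simp add: x_def)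
  moreover have "2 * (x - 1) / (x + 1) = 2 / (2 * real n + 1)"
    using n by (simp add: x_def field_simps)
  moreover have "x = real (Suc n) / real n" using n by (simp add: x_def field_simps)
  then have "ln x = ln (real (Suc n)) - ln (real n)" using n by (simp add: ln_div)
  ultimately have "2 / (2 * real n + 1) \<le> ln (real (Suc n)) - ln (real n)" by simp
  then have "1 \<le> (real n + 1 / 2) * (ln (real (Suc n)) - ln (real n))"
    using n by (simp add: field_simps)
  then show ?case
    using step.IH unfolding ln_fact_Suc by (simp add: algebra_simps)
qed simp

text \<open>The bound n! \<ge> (n/e)^n, used for the factorial that the padding rows contribute. The
  step reduces to n ln(1 + 1/n) \<le> 1; at n = 0 the factor n absorbs the value of
  \<open>ln 0\<close>.\<close>

lemma ln_fact_ge: "real n * ln (real n) - real n \<le> ln (fact n :: real)"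
proof (induction n)
  case (Suc n)
  have "real n * (ln (real (Suc n)) - ln (real n)) \<le> 1"
  proof (cases "n = 0")
    case False
    have "ln (real (Suc n)) - ln (real n) = ln (1 + 1 / real n)"
      using False ln_div[of "real (Suc n)" "real n"] by (simp add: add_divide_distrib add.commute)
    also have "\<dots> \<le> 1 / real n" by (intro ln_add_one_self_le_self) simp
    finally show ?thesis using False by (simp add: field_simps)
  qed simp
  then show ?case
    using Suc.IH unfolding ln_fact_Suc by (simp add: algebra_simps)
qed simp

lemma ln2_mult_log_quot: "ln 2 * log_quot x = (if x = 1 then 1 else ln x / (x - 1))"
  by (simp add: log_quot_def log_def)

text \<open>Up to the factor ln 2, the quotient is the slope of the chord of the concave function ln
  from 1 to x. It allows every row size to be replaced by the minimum degree.\<close>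

lemma log_quot_antimono:
  assumes "1 \<le> a" "a \<le> b"
  shows "log_quot b \<le> log_quot a"
proof -
  consider "b = 1" | "a = 1" "1 < b" | "1 < a" using assms by linarith
  then show ?thesis
  proof cases
    case 1
    then show ?thesis using assms by simp
  next
    case 2
    then have "ln b \<le> b - 1" by (simp add: ln_le_minus_one)
    then have "ln 2 * log_quot b \<le> ln 2 * log_quot a"
      using 2 unfolding ln2_mult_log_quot by simp
    then show ?thesis by simp
  next
    case 3
    \<comment> \<open>The tangent at a bounds ln b; its slope 1/a is in turn at most the chord slope
      ln a / (a - 1).\<close>
    have "ln b = ln a + ln (b / a)" using assms 3 by (simp add: ln_div)
    also have "\<dots> \<le> ln a + (b - a) / a"
      using assms 3 ln_le_minus_one[of "b / a"] by (simp add: field_simps)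
    finally have "(a - 1) * ln b \<le> (a - 1) * (ln a + (b - a) / a)"
      using 3 by (intro mult_left_mono) auto
    moreover have "(a - 1) / a \<le> ln a"
      using ln_le_minus_one[of "1 / a"] 3 by (simp add: ln_div field_simps)
    then have "(b - a) * ((a - 1) / a) \<le> (b - a) * ln a"
      using assms by (intro mult_left_mono) auto
    ultimately have "(a - 1) * ln b \<le> (b - 1) * ln a"
      by (simp add: algebra_simps)
    then have "ln 2 * log_quot b \<le> ln 2 * log_quot a"
      using 3 assms unfolding ln2_mult_log_quot by (simp add: field_simps)
    then show ?thesis by simp
  qed
qed

text \<open>Turns a Bregman factor (d!)^(1/d) into d/e times the correction d^(1/(d-1)). After
  Stirling, what remains for n > 1 is 1 + ln n / 2 \<le> n ln n / (n - 1), a rearrangement of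
  \<open>ln_ge_two_mult_div\<close>; at n = 1 the convention for \<open>log_quot\<close> gives
  equality.\<close>

lemma ln_fact_div_le:
  assumes "1 \<le> n"
  shows "ln (fact n :: real) / real n \<le> ln (real n) - 1 + ln 2 * log_quot (real n)"
proof (cases "n = 1")
  case True
  then show ?thesis by (simp add: log_quot_def log_def)
next
  case False
  then have n: "1 < real n" using assms by simp
  have "2 * (real n - 1) / (real n + 1) \<le> ln (real n)"
    using n by (intro ln_ge_two_mult_div) simp
  then have "1 + ln (real n) / 2 \<le> real n * (ln (real n) / (real n - 1))"
    using n by (simp add: field_simps)
  with ln_fact_le[OF assms]
  have "ln (fact n :: real) \<le> real n * (ln (real n) - 1 + ln (real n) / (real n - 1))"
    by (simp add: algebra_simps)
  then have "ln (fact n :: real) / real n \<le> ln (real n) - 1 + ln (real n) / (real n - 1)"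
    using n by (simp add: mult.commute pos_divide_le_eq)
  then show ?thesis using n False unfolding ln2_mult_log_quot by simp
qed

text \<open>Jensen's inequality for the convex function x ln x, proved termwise from ln x \<le> x -
  1. Zero entries are harmless because the product with \<open>ln 0\<close> is 0.\<close>

lemma sum_mult_ln_ge:
  fixes t :: "'a \<Rightarrow> real"
  assumes "finite K" "K \<noteq> {}" and nonneg: "\<And>k. k \<in> K \<Longrightarrow> 0 \<le> t k"
  shows "sum t K * ln (sum t K) \<le> sum t K * ln (real (card K)) + (\<Sum>k\<in>K. t k * ln (t k))"
proof (cases "sum t K = 0")
  case True
  then have "t k = 0" if "k \<in> K" for k
    using that assms by (simp add: sum_nonneg_eq_0_iff)
  with True show ?thesis by simp
next
  case False
  define T where "T = sum t K"
  define r where "r = real (card K)"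
  have T: "0 < T" using False nonneg by (simp add: T_def sum_nonneg less_le)
  have r: "0 < r" using assms by (simp add: r_def card_gt_0_iff)
  have "t k * (ln T - ln r - ln (t k)) \<le> T / r - t k" if "k \<in> K" for k
  proof (cases "t k = 0")
    case True
    then show ?thesis using T r by simp
  next
    case False
    with nonneg that have t: "0 < t k" by (simp add: less_le)
    have "ln T - ln r - ln (t k) = ln (T / (r * t k))"
      using T r t by (simp add: ln_div ln_mult)
    also have "\<dots> \<le> T / (r * t k) - 1" using T r t by (intro ln_le_minus_one) simp
    finally have "t k * (ln T - ln r - ln (t k)) \<le> t k * (T / (r * t k) - 1)"
      using t by simp
    also have "\<dots> = T / r - t k" using t by (simp add: field_simps)
    finally show ?thesis .
  qed
  then have "(\<Sum>k\<in>K. t k * (ln T - ln r - ln (t k))) \<le> (\<Sum>k\<in>K. T / r - t k)"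
    by (rule sum_mono)
  also have "\<dots> = r * (T / r) - T" by (simp add: sum_subtractf T_def r_def)
  also have "\<dots> = 0" using r by simp
  finally have "(\<Sum>k\<in>K. t k * (ln T - ln r - ln (t k))) \<le> 0" .
  moreover have "(\<Sum>k\<in>K. t k * (ln T - ln r - ln (t k)))
      = T * (ln T - ln r) - (\<Sum>k\<in>K. t k * ln (t k))"
    by (simp add: right_diff_distrib sum_subtractf T_def sum_distrib_right[symmetric])
  ultimately show ?thesis by (simp add: T_def r_def algebra_simps)
qed

subsection \<open>Bregman's theorem\<close>

text \<open>Systems of distinct representatives. Their number is the permanent of the 0-1 matrix
  with row set \<open>A\<close> in which row \<open>a\<close> has support \<open>N a\<close>, for
  square as well as rectangular matrices.\<close>

definition inj_sections :: "'a set \<Rightarrow> ('a \<Rightarrow> 'b set) \<Rightarrow> ('a \<Rightarrow> 'b) set" where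
  "inj_sections A N = {f \<in> Pi\<^sub>E A N. inj_on f A}"

lemma finite_inj_sections:
  "finite A \<Longrightarrow> (\<And>a. a \<in> A \<Longrightarrow> finite (N a)) \<Longrightarrow> finite (inj_sections A N)"
  unfolding inj_sections_def by (simp add: finite_PiE)

text \<open>Comparison with the minor that omits row \<open>i\<close> and column \<open>k\<close>:
  once the value at \<open>i\<close> is fixed, restriction loses no information, and injectivity
  keeps \<open>k\<close> away from the other rows.\<close>

lemma card_inj_sections_fixed_le:
  assumes "finite A" "\<And>a. a \<in> A \<Longrightarrow> finite (N a)" "i \<in> A"
  shows "card {f \<in> inj_sections A N. f i = k}
    \<le> card (inj_sections (A - {i}) (\<lambda>j. N j - {k}))"
proof (rule card_inj_on_le[where f = "\<lambda>f. restrict f (A - {i})"])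
  show "inj_on (\<lambda>f. restrict f (A - {i})) {f \<in> inj_sections A N. f i = k}"
  proof (rule inj_onI)
    fix f g
    assume f: "f \<in> {f \<in> inj_sections A N. f i = k}" and g: "g \<in> {f \<in> inj_sections A N. f i = k}"
      and eq: "restrict f (A - {i}) = restrict g (A - {i})"
    have "f x = g x" if "x \<in> A" for x
      using fun_cong[OF eq, of x] f g that by (cases "x = i") simp_all
    then show "f = g"
      using f g by (intro PiE_ext[of f A N g]) (auto simp: inj_sections_def)
  qed
  show "(\<lambda>f. restrict f (A - {i})) ` {f \<in> inj_sections A N. f i = k}
      \<subseteq> inj_sections (A - {i}) (\<lambda>j. N j - {k})"
    using assms(3) by (auto simp: inj_sections_def PiE_iff inj_on_def)
  show "finite (inj_sections (A - {i}) (\<lambda>j. N j - {k}))"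
    using assms by (intro finite_inj_sections) auto
qed

text \<open>
  Schrijver's proof: expand \<open>t ln t\<close>, with \<open>t\<close> the number of sections, along every row by convexity,
  bound the minors by induction, and exchange the order of summation.
\<close>

lemma bregman:
  assumes "finite B" "finite A" "card A = card B" "\<And>a. a \<in> A \<Longrightarrow> N a \<subseteq> B"
    "inj_sections A N \<noteq> {}"
  shows "ln (real (card (inj_sections A N)))
    \<le> (\<Sum>a\<in>A. ln (fact (card (N a))) / real (card (N a)))"
  using assms
proof (induction "card A" arbitrary: A B N)
  case 0
  then have "A = {}" by simp
  then show ?case by (simp add: inj_sections_def)
next
  case (Suc m)
  define n where "n = card A"
  define G where "G = (\<lambda>r::nat. ln (fact r :: real) / real r)"
  define T where "T = inj_sections A N"
  define r where "r = (\<lambda>a. card (N a))"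
  define t where "t = (\<lambda>i k. card {f \<in> T. f i = k})"
  have finN: "finite (N a)" if "a \<in> A" for a
    using Suc.prems that finite_subset by blast
  have finT: "finite T"
    unfolding T_def using Suc.prems finN by (intro finite_inj_sections) auto
  have T: "0 < card T" using Suc.prems(5) finT by (simp add: T_def card_gt_0_iff)
  have memT: "f a \<in> N a" if "f \<in> T" "a \<in> A" for f a
    using that by (auto simp: T_def inj_sections_def)
  have r_pos: "0 < r a" if "a \<in> A" for a
    using Suc.prems(5) memT[OF _ that] finN[OF that] by (auto simp: r_def card_gt_0_iff T_def)
  have bij: "bij_betw f A B" if "f \<in> T" for f
  proof -
    have "inj_on f A" "f ` A \<subseteq> B"
      using that Suc.prems(4) by (auto simp: T_def inj_sections_def)
    then have "f ` A = B"
      using Suc.prems(1,3) by (intro card_subset_eq) (auto simp: card_image)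
    with \<open>inj_on f A\<close> show ?thesis by (simp add: bij_betw_def)
  qed
  have group: "(\<Sum>k\<in>N i. \<Sum>f\<in>{f \<in> T. f i = k}. h f) = (sum h T :: real)"
    if "i \<in> A" for i and h
    using sum.group[OF finT finN[OF that], of "\<lambda>f. f i" h] memT that by blast
  \<comment> \<open>Since \<open>t i k\<close> counts the sections with value \<open>k\<close> at
    \<open>i\<close>, the weighted sum of logarithms over \<open>k\<close> regroups into a sum over
    all sections \<open>f\<close>.\<close>
  have row: "card T * ln (card T) \<le> (\<Sum>f\<in>T. ln (r i) + ln (t i (f i)))" if "i \<in> A" for i
  proof -
    have sumt: "(\<Sum>k\<in>N i. real (t i k)) = card T"
      using group[OF that, of "\<lambda>_. 1"] by (simp add: t_def)
    have "card T * ln (card T) \<le> card T * ln (r i) + (\<Sum>k\<in>N i. t i k * ln (t i k))"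
      using sum_mult_ln_ge[of "N i" "\<lambda>k. real (t i k)"] finN[OF that] r_pos[OF that]
      unfolding sumt r_def by force
    also have "(\<Sum>k\<in>N i. t i k * ln (t i k)) = (\<Sum>k\<in>N i. \<Sum>f\<in>{f \<in> T. f i = k}. ln (t i (f i)))"
      by (intro sum.cong) (auto simp: t_def)
    also have "\<dots> = (\<Sum>f\<in>T. ln (t i (f i)))" by (rule group[OF that])
    finally show ?thesis by (simp add: sum.distrib)
  qed
  \<comment> \<open>The section \<open>f\<close> itself is counted by \<open>t i (f i)\<close>, so
    the minor has a section and the induction hypothesis applies.\<close>
  have minor: "ln (t i (f i)) \<le> (\<Sum>j\<in>A - {i}. G (card (N j - {f i})))" if "f \<in> T" "i \<in> A" for f i
  proof -
    let ?S = "inj_sections (A - {i}) (\<lambda>j. N j - {f i})"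
    have "0 < t i (f i)" using that finT by (auto simp: t_def card_gt_0_iff)
    moreover have "t i (f i) \<le> card ?S"
      unfolding t_def T_def using that Suc.prems finN by (intro card_inj_sections_fixed_le)
    moreover have "ln (card ?S) \<le> (\<Sum>j\<in>A - {i}. G (card (N j - {f i})))"
      unfolding G_def
    proof (rule Suc.hyps(1))
      show "m = card (A - {i})" using Suc that by simp
      have "f i \<in> B" using memT[OF that] Suc.prems(4)[OF that(2)] by blast
      then show "card (A - {i}) = card (B - {f i})" using Suc that by simp
      show "?S \<noteq> {}" using calculation by auto
    qed (use Suc.prems in auto)
    ultimately show ?thesis by (smt (verit) ln_le_cancel_iff of_nat_0_less_iff of_nat_le_iff)
  qed
  \<comment> \<open>With r = \<open>r j\<close>, the minors contribute (n - r) G(r) + (r - 1) G(r -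
    1) = n G(r) - ln r for row \<open>j\<close>, and the terms - ln r cancel the row terms
    \<open>ln (r i)\<close>.\<close>
  have perm: "(\<Sum>i\<in>A. ln (r i) + (\<Sum>j\<in>A - {i}. G (card (N j - {f i})))) = n * (\<Sum>j\<in>A. G (r j))"
    if f: "f \<in> T" for f
  proof -
    have "(\<Sum>i\<in>A. \<Sum>j\<in>A - {i}. G (card (N j - {f i})))
        = (\<Sum>j\<in>A. \<Sum>i\<in>A - {j}. G (card (N j - {f i})))"
      using sum.swap_restrict[OF Suc.prems(2) Suc.prems(2),
          of "\<lambda>i j. G (card (N j - {f i}))" "\<lambda>i j. i \<noteq> j"]
      by (simp add: set_diff_eq conj_commute eq_commute)
    also have "\<dots> = (\<Sum>j\<in>A. n * G (r j) - ln (r j))"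
    proof (rule sum.cong[OF refl])
      fix j assume j: "j \<in> A"
      \<comment> \<open>As \<open>f\<close> is a bijection, deleting column \<open>f i\<close> shortens row \<open>j\<close> for exactly \<open>r j - 1\<close> rows
        \<open>i \<noteq> j\<close>.\<close>
      define C where "C = {i \<in> A. f i \<in> N j}"
      have "f ` C = N j"
        using bij[OF f] Suc.prems(4)[OF j] by (auto simp: C_def bij_betw_def)
      moreover have "inj_on f C"
        using bij[OF f] by (auto simp: C_def bij_betw_def inj_on_def)
      ultimately have cC: "card C = r j" by (metis card_image r_def)
      have jC: "j \<in> C" using j memT[OF f j] by (simp add: C_def)
      have CA: "C \<subseteq> A" "finite C" using Suc.prems by (auto simp: C_def)
      have "A - {j} = (A - C) \<union> (C - {j})" using jC CA by auto
      then have "(\<Sum>i\<in>A - {j}. G (card (N j - {f i})))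
          = (\<Sum>i\<in>A - C. G (card (N j - {f i}))) + (\<Sum>i\<in>C - {j}. G (card (N j - {f i})))"
        using Suc.prems(2) CA by (simp only:) (intro sum.union_disjoint, auto)
      also have "(\<Sum>i\<in>A - C. G (card (N j - {f i}))) = (\<Sum>i\<in>A - C. G (r j))"
        by (intro sum.cong) (auto simp: C_def r_def)
      also have "(\<Sum>i\<in>C - {j}. G (card (N j - {f i}))) = (\<Sum>i\<in>C - {j}. G (r j - 1))"
        by (intro sum.cong) (auto simp: C_def r_def)
      also have "(\<Sum>i\<in>A - C. G (r j)) = (real n - r j) * G (r j)"
        using CA cC card_mono[OF Suc.prems(2) CA(1)]
        by (simp add: card_Diff_subset n_def of_nat_diff)
      also have "(\<Sum>i\<in>C - {j}. G (r j - 1)) = real (r j - 1) * G (r j - 1)"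
        using jC cC by simp
      \<comment> \<open>For \<open>r j = 1\<close> the set \<open>C - {j}\<close> is empty and both
        sides are 0.\<close>
      also have "real (r j - 1) * G (r j - 1) = ln (fact (r j)) - ln (r j)"
        using r_pos[OF j] ln_fact_Suc[of "r j - 1"] by (cases "r j = 1") (auto simp: G_def)
      also have "ln (fact (r j)) = r j * G (r j)" using r_pos[OF j] by (simp add: G_def)
      finally show "(\<Sum>i\<in>A - {j}. G (card (N j - {f i}))) = n * G (r j) - ln (r j)"
        by (simp add: algebra_simps)
    qed
    finally show ?thesis by (simp add: sum.distrib sum_subtractf sum_distrib_left)
  qed
  have "n * (card T * ln (card T)) \<le> (\<Sum>i\<in>A. \<Sum>f\<in>T. ln (r i) + ln (t i (f i)))"
    using sum_mono[OF row] by (simp add: n_def)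
  also have "\<dots> = (\<Sum>f\<in>T. \<Sum>i\<in>A. ln (r i) + ln (t i (f i)))" by (rule sum.swap)
  also have "\<dots> \<le> (\<Sum>f\<in>T. \<Sum>i\<in>A. ln (r i) + (\<Sum>j\<in>A - {i}. G (card (N j - {f i}))))"
    using minor by (intro sum_mono add_left_mono)
  also have "\<dots> = card T * (n * (\<Sum>j\<in>A. G (r j)))" using perm by simp
  finally have "(n * card T) * ln (card T) \<le> (n * card T) * (\<Sum>j\<in>A. G (r j))"
    by (simp add: algebra_simps)
  moreover have "0 < real (n * card T)" using T Suc.hyps(2) by (simp add: n_def)
  ultimately have "ln (card T) \<le> (\<Sum>j\<in>A. G (r j))"
    using mult_le_cancel_left_pos by blast
  then show ?case by (simp add: T_def G_def r_def)
qed

subsection \<open>Rectangular matrices\<close>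

text \<open>The image of a section on \<open>A\<close> consists of \<open>card A\<close> elements of
  \<open>N a\<close>, so every remaining element of \<open>N a\<close> extends it
  injectively.\<close>

lemma card_inj_sections_insert_ge:
  assumes "finite A" "a \<notin> A" "finite (N a)" "\<And>x. x \<in> A \<Longrightarrow> N x \<subseteq> N a"
  shows "card (inj_sections A N) * (card (N a) - card A) \<le> card (inj_sections (insert a A) N)"
proof -
  let ?D = "SIGMA f : inj_sections A N. N a - f ` A"
  have fin: "finite (inj_sections B N)" if "B \<subseteq> insert a A" for B
    using that assms by (intro finite_inj_sections) (auto intro: finite_subset)
  have "card ?D = (\<Sum>f\<in>inj_sections A N. card (N a) - card A)"
  proof (subst card_SigmaI)
    show "finite (inj_sections A N)" by (intro fin) auto
    show "(\<Sum>f\<in>inj_sections A N. card (N a - f ` A)) = (\<Sum>f\<in>inj_sections A N. card (N a) - card A)"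
    proof (rule sum.cong[OF refl])
      fix f assume "f \<in> inj_sections A N"
      then have "f ` A \<subseteq> N a" "card (f ` A) = card A"
        using assms(4) by (auto simp: inj_sections_def card_image)
      then show "card (N a - f ` A) = card (N a) - card A"
        using assms by (simp add: card_Diff_subset finite_subset)
    qed
  qed (use assms in auto)
  moreover have "card ?D \<le> card (inj_sections (insert a A) N)"
  proof (rule card_inj_on_le[where f = "\<lambda>(f, y). f(a := y)"])
    show "inj_on (\<lambda>(f, y). f(a := y)) ?D"
    proof (rule inj_onI, clarify)
      fix f y g z
      assume f: "f \<in> inj_sections A N" and g: "g \<in> inj_sections A N"
        and eq: "f(a := y) = g(a := z)"
      have "f x = g x" if "x \<in> A" for x
        using fun_cong[OF eq, of x] that assms(2) by (auto split: if_splits)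
      then have "f = g"
        using f g by (intro PiE_ext[of f A N g]) (auto simp: inj_sections_def)
      then show "f = g \<and> y = z" using fun_cong[OF eq, of a] by simp
    qed
    show "(\<lambda>(f, y). f(a := y)) ` ?D \<subseteq> inj_sections (insert a A) N"
    proof clarify
      fix f y assume f: "f \<in> inj_sections A N" and y: "y \<in> N a" "y \<notin> f ` A"
      then have "f(a := y) \<in> Pi\<^sub>E (insert a A) N"
        by (intro PiE_fun_upd) (auto simp: inj_sections_def)
      moreover have "inj_on (f(a := y)) (insert a A)"
        using f y assms(2) by (auto simp: inj_sections_def inj_on_def)
      ultimately show "f(a := y) \<in> inj_sections (insert a A) N"
        by (simp add: inj_sections_def)
    qed
  qed (intro fin, auto)
  ultimately show ?thesis by simp
qed

text \<open>Full rows added one at a time leave |Y| - |A|, |Y| - |A| - 1, ... choices. Their product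
  is a quotient of two factorials, here cleared of the denominator.\<close>

lemma card_inj_sections_Un_ge:
  assumes "finite K" "finite A" "A \<inter> K = {}" "finite Y" "\<And>x. x \<in> A \<Longrightarrow> N x \<subseteq> Y"
    and "\<And>x. x \<in> K \<Longrightarrow> N x = Y" "card A + card K \<le> card Y"
  shows "card (inj_sections A N) * fact (card Y - card A)
    \<le> card (inj_sections (A \<union> K) N) * fact (card Y - card A - card K)"
  using assms(1,3,6,7)
proof (induction K)
  case (insert a K)
  define m where "m = card Y - card A - card (insert a K)"
  have m: "Suc m = card Y - card (A \<union> K)" "Suc m = card Y - card A - card K"
    using insert assms(2) by (auto simp: m_def card_Un_disjoint)
  have "card (inj_sections A N) * fact (card Y - card A)
      \<le> card (inj_sections (A \<union> K) N) * fact (Suc m)"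
    using insert unfolding m(2) by auto
  also have "\<dots> = (card (inj_sections (A \<union> K) N) * Suc m) * fact m" by (simp add: algebra_simps)
  also have "card (inj_sections (A \<union> K) N) * Suc m \<le> card (inj_sections (insert a (A \<union> K)) N)"
    using card_inj_sections_insert_ge[of "A \<union> K" a N] insert assms(2,4,5) m(1) by auto
  finally show ?case by (simp add: m_def)
qed simp

text \<open>The terms \<alpha> ln \<alpha> cancel, leaving - (1 - \<alpha>) ln (1 - \<alpha>) -
  \<alpha>. Scaled by n, this is the form in which padding and Stirling produce the bound. The
  extremes l = 0 and l = n rest on 0 times \<open>ln 0\<close> being 0.\<close>

lemma ln2_mult_bin_entropy:
  assumes "l \<le> n" "1 \<le> n"
  defines "\<alpha> \<equiv> real l / real n"
  shows "ln 2 * (real n * (bin_entropy \<alpha> + \<alpha> * log 2 (\<alpha> / exp 1)))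
    = real (n - l) * (ln (real n) - ln (real (n - l))) - real l"
proof -
  have n: "0 < real n" using assms by simp
  have "ln 2 * (bin_entropy \<alpha> + \<alpha> * log 2 (\<alpha> / exp 1))
      = - \<alpha> * ln \<alpha> - (1 - \<alpha>) * ln (1 - \<alpha>) + \<alpha> * ln (\<alpha> / exp 1)"
    by (simp add: bin_entropy_def log_def field_simps)
  also have "\<alpha> * ln (\<alpha> / exp 1) = \<alpha> * ln \<alpha> - \<alpha>"
  proof (cases "l = 0")
    case False
    then have "0 < \<alpha>" using n by (simp add: \<alpha>_def)
    then show ?thesis by (simp add: ln_div right_diff_distrib)
  qed (simp add: \<alpha>_def)
  finally have eq: "ln 2 * (bin_entropy \<alpha> + \<alpha> * log 2 (\<alpha> / exp 1))
      = - (1 - \<alpha>) * ln (1 - \<alpha>) - \<alpha>" by (simp add: algebra_simps)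
  have "ln 2 * (real n * (bin_entropy \<alpha> + \<alpha> * log 2 (\<alpha> / exp 1)))
      = real n * (ln 2 * (bin_entropy \<alpha> + \<alpha> * log 2 (\<alpha> / exp 1)))"
    by (simp only: mult.left_commute)
  also have "\<dots> = - (real n * (1 - \<alpha>)) * ln (1 - \<alpha>) - real n * \<alpha>"
    unfolding eq by (simp add: algebra_simps)
  also have "real n * \<alpha> = real l" using n by (simp add: \<alpha>_def)
  also have "- (real n * (1 - \<alpha>)) * ln (1 - \<alpha>) = real (n - l) * (ln (real n) - ln (real (n - l)))"
  proof (cases "n = l")
    case False
    then have "0 < real (n - l)" using assms(1) by simp
    moreover have "1 - \<alpha> = real (n - l) / real n"
      using n assms(1) by (simp add: \<alpha>_def of_nat_diff diff_divide_distrib)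
    ultimately have "ln (1 - \<alpha>) = ln (real (n - l)) - ln (real n)" "real n * (1 - \<alpha>) = real (n - l)"
      using n ln_div[of "real (n - l)" "real n"] by auto
    then show ?thesis by (simp add: right_diff_distrib)
  qed (use n in \<open>simp add: \<alpha>_def\<close>)
  finally show ?thesis .
qed

text \<open>Padding multiplies the count by at least (n - l)!, Bregman bounds the padded square
  permanent, and dividing the factorial out again by Stirling leaves the entropy term.\<close>

lemma card_inj_sections_le:
  fixes S :: "'a set" and N :: "'a \<Rightarrow> 'b set"
  assumes "finite S" "finite Y" "card S \<le> card Y" "1 \<le> \<delta>" "\<delta> \<le> card Y"
    and N: "\<And>x. x \<in> S \<Longrightarrow> N x \<subseteq> Y" "\<And>x. x \<in> S \<Longrightarrow> \<delta> \<le> card (N x)"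
  defines "\<alpha> \<equiv> real (card S) / real (card Y)"
  shows "real (card (inj_sections S N)) \<le> (\<Prod>x\<in>S. real (card (N x))) *
    2 powr (real (card Y) * (bin_entropy \<alpha> + \<alpha> * log 2 (\<alpha> / exp 1) + log_quot (real \<delta>)))"
proof (cases "inj_sections S N = {}")
  case True
  then show ?thesis by (simp add: prod_nonneg)
next
  case False
  define n where "n = card Y"
  define l where "l = card S"
  define L where "L = ln 2 * log_quot (real \<delta>)"
  define c where "c = card (inj_sections S N)"
  \<comment> \<open>The sum type supplies fresh indices for the n - l padding rows.\<close>
  define A :: "('a + nat) set" where "A = Inl ` S"
  define K :: "('a + nat) set" where "K = Inr ` {..<n - l}"
  define N' where "N' = case_sum N (\<lambda>_::nat. Y)"
  define G where "G = (\<lambda>r::nat. ln (fact r :: real) / real r)"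
  have l_le_n: "l \<le> n" "1 \<le> n" using assms by (auto simp: l_def n_def)
  have finN: "finite (N x)" if "x \<in> S" for x using N(1)[OF that] assms(2) finite_subset by blast
  have c: "0 < c"
    using False finN assms(1) by (simp add: c_def card_gt_0_iff finite_inj_sections)
  have A: "finite A" "finite K" "A \<inter> K = {}" "card A = l" "card K = n - l"
    using assms(1) by (auto simp: A_def K_def l_def card_image)
  have N'A: "N' x \<subseteq> Y" if "x \<in> A" for x using that N(1) by (fastforce simp: A_def N'_def)
  have N'K: "N' x = Y" if "x \<in> K" for x using that by (auto simp: K_def N'_def)
  have "c \<le> card (inj_sections A N')"
    unfolding c_def
  proof (rule card_inj_on_le[where f = "\<lambda>f. \<lambda>x\<in>A. f (projl x)"])
    show "inj_on (\<lambda>f. \<lambda>x\<in>A. f (projl x)) (inj_sections S N)"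
    proof (rule inj_onI)
      fix f g assume fg: "f \<in> inj_sections S N" "g \<in> inj_sections S N"
        and eq: "(\<lambda>x\<in>A. f (projl x)) = (\<lambda>x\<in>A. g (projl x))"
      have "f x = g x" if "x \<in> S" for x
        using fun_cong[OF eq, of "Inl x"] that by (simp add: A_def)
      then show "f = g"
        using fg by (intro PiE_ext[of f S N g]) (auto simp: inj_sections_def)
    qed
    show "(\<lambda>f. \<lambda>x\<in>A. f (projl x)) ` inj_sections S N \<subseteq> inj_sections A N'"
      by (auto simp: inj_sections_def A_def N'_def inj_on_def PiE_iff)
    show "finite (inj_sections A N')"
      using A N'A assms(2) finite_subset by (intro finite_inj_sections) blast+
  qed
  then have "c * fact (n - l) \<le> card (inj_sections A N') * fact (n - l)" by simp
  also have "\<dots> \<le> card (inj_sections (A \<union> K) N')"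
    using card_inj_sections_Un_ge[OF A(2,1,3) assms(2) N'A N'K] A l_le_n by (simp add: n_def)
  finally have le: "c * fact (n - l) \<le> card (inj_sections (A \<union> K) N')" .
  then have pos: "0 < card (inj_sections (A \<union> K) N')"
    using c by (metis fact_gt_zero gr0I le_zero_eq mult_eq_0_iff less_irrefl)
  have "ln (real c) + ln (fact (n - l)) = ln (real (c * fact (n - l)))"
    using c by (simp add: ln_mult)
  also have "\<dots> \<le> ln (real (card (inj_sections (A \<union> K) N')))"
    using le c pos by (subst ln_le_cancel_iff) (auto simp del: of_nat_mult)
  also have "\<dots> \<le> (\<Sum>a\<in>A \<union> K. G (card (N' a)))"
    unfolding G_def
  proof (rule bregman[OF assms(2)])
    show "card (A \<union> K) = card Y" using A l_le_n by (simp add: card_Un_disjoint n_def)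
    show "inj_sections (A \<union> K) N' \<noteq> {}" using pos by auto
  qed (use A N'A N'K in auto)
  also have "\<dots> = (\<Sum>a\<in>A. G (card (N' a))) + (\<Sum>a\<in>K. G (card (N' a)))"
    using A by (intro sum.union_disjoint) auto
  also have "(\<Sum>a\<in>A. G (card (N' a))) = (\<Sum>x\<in>S. G (card (N x)))"
    by (simp add: A_def N'_def sum.reindex)
  also have "(\<Sum>a\<in>K. G (card (N' a))) = real (n - l) * G n"
    using N'K A by (simp add: n_def)
  \<comment> \<open>All n rows have size at least \<delta>, the padding rows because \<delta> \<le>
    |Y|, so each pays the same correction \<open>L\<close>.\<close>
  also have "(\<Sum>x\<in>S. G (card (N x))) + real (n - l) * G n
      \<le> (\<Sum>x\<in>S. ln (real (card (N x))) - 1 + L) + real (n - l) * (ln (real n) - 1 + L)"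
  proof -
    have G: "G d \<le> ln (real d) - 1 + L" if "\<delta> \<le> d" for d
    proof -
      have "log_quot (real d) \<le> log_quot (real \<delta>)"
        using that assms(4) by (intro log_quot_antimono) auto
      moreover have "G d \<le> ln (real d) - 1 + ln 2 * log_quot (real d)"
        unfolding G_def using that assms(4) by (intro ln_fact_div_le) simp
      ultimately show ?thesis unfolding L_def by (smt (verit) ln_gt_zero mult_left_mono)
    qed
    show ?thesis
      using assms(5) N(2) by (intro add_mono sum_mono mult_left_mono G) (auto simp: n_def)
  qed
  also have "\<dots> = (\<Sum>x\<in>S. ln (real (card (N x)))) + real (n - l) * ln (real n) - real n + real n * L"
    using l_le_n by (simp add: sum.distrib sum_subtractf l_def[symmetric] of_nat_diff algebra_simps)
  finally have "ln (real c) \<le> (\<Sum>x\<in>S. ln (real (card (N x))))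
      + (real (n - l) * (ln (real n) - ln (real (n - l))) - real l) + real n * L"
    using ln_fact_ge[of "n - l"] l_le_n by (simp add: of_nat_diff algebra_simps)
  also have "\<dots> = (\<Sum>x\<in>S. ln (real (card (N x)))) + ln 2 *
      (real n * (bin_entropy \<alpha> + \<alpha> * log 2 (\<alpha> / exp 1) + log_quot (real \<delta>)))"
    using ln2_mult_bin_entropy[OF l_le_n]
    by (simp add: \<alpha>_def l_def n_def L_def algebra_simps)
  finally have "exp (ln (real c)) \<le> exp ((\<Sum>x\<in>S. ln (real (card (N x)))) + ln 2 *
      (real n * (bin_entropy \<alpha> + \<alpha> * log 2 (\<alpha> / exp 1) + log_quot (real \<delta>))))"
    by (simp only: exp_le_cancel_iff)
  then have "real c \<le> exp ((\<Sum>x\<in>S. ln (real (card (N x)))) + ln 2 *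
      (real n * (bin_entropy \<alpha> + \<alpha> * log 2 (\<alpha> / exp 1) + log_quot (real \<delta>))))"
    using c by (simp only: exp_ln of_nat_0_less_iff)
  moreover have "exp (\<Sum>x\<in>S. ln (real (card (N x)))) = (\<Prod>x\<in>S. real (card (N x)))"
    unfolding exp_sum[OF assms(1)] using N(2) assms(4) by (intro prod.cong) force+
  ultimately show ?thesis
    by (simp add: exp_add powr_def c_def n_def mult.commute)
qed

section \<open>Partial injections and the sum over row sets\<close>

text \<open>Matchings of a bipartite graph, written as sets of ordered pairs. The two sides may be
  the same set, which is how the bipartite double cover is represented.\<close>

definition partial_injections :: "'a set \<Rightarrow> ('a \<Rightarrow> 'b set) \<Rightarrow> nat \<Rightarrow> ('a \<times> 'b) set set" where
  "partial_injections X N l = {A. A \<subseteq> Sigma X N \<and> card A = l \<and> inj_on fst A \<and> inj_on snd A}"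

lemma finite_partial_injections:
  assumes "finite X" "\<And>x. x \<in> X \<Longrightarrow> finite (N x)"
  shows "finite (partial_injections X N l)"
proof (rule finite_subset)
  show "partial_injections X N l \<subseteq> Pow (Sigma X N)" by (auto simp: partial_injections_def)
qed (use assms in auto)

text \<open>A partial injection is the graph of an injective section on its domain, so pairs of a
  domain and a section on it cover all partial injections.\<close>

lemma card_partial_injections_le_sum:
  assumes "finite X" "\<And>x. x \<in> X \<Longrightarrow> finite (N x)"
  shows "card (partial_injections X N l) \<le> (\<Sum>S | S \<subseteq> X \<and> card S = l. card (inj_sections S N))"
proof -
  let ?D = "SIGMA S : {S. S \<subseteq> X \<and> card S = l}. inj_sections S N"
  have finS: "finite {S. S \<subseteq> X \<and> card S = l}" using assms(1) by simp
  have fin: "finite (inj_sections S N)" if "S \<subseteq> X" for S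
    using that assms by (intro finite_inj_sections) (auto intro: finite_subset)
  have "partial_injections X N l \<subseteq> (\<lambda>(S, f). (\<lambda>x. (x, f x)) ` S) ` ?D"
  proof
    fix A assume A: "A \<in> partial_injections X N l"
    define S where "S = fst ` A"
    define f where "f = (\<lambda>x\<in>S. snd (inv_into A fst x))"
    have f: "f x = y" if "(x, y) \<in> A" for x y
      using A that inv_into_f_f[of fst A "(x, y)"]
      by (force simp: f_def S_def partial_injections_def)
    have "S \<subseteq> X" "card S = l" using A by (auto simp: S_def partial_injections_def card_image)
    moreover have "f \<in> inj_sections S N"
    proof -
      have "f x \<in> N x" if "x \<in> S" for x
        using that A f by (force simp: S_def partial_injections_def)
      then have "f \<in> Pi\<^sub>E S N" by (auto simp: f_def)
      moreover have "inj_on f S"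
      proof (rule inj_onI)
        fix x x' assume "x \<in> S" "x' \<in> S" "f x = f x'"
        then obtain y y' where "(x, y) \<in> A" "(x', y') \<in> A" by (auto simp: S_def)
        moreover from this have "y = y'" using f \<open>f x = f x'\<close> by metis
        moreover have "inj_on snd A" using A by (simp add: partial_injections_def)
        ultimately show "x = x'" by (auto dest: inj_onD[of snd A "(x, y)" "(x', y')"])
      qed
      ultimately show ?thesis by (simp add: inj_sections_def)
    qed
    moreover have "A = (\<lambda>x. (x, f x)) ` S" using f by (force simp: S_def)
    ultimately show "A \<in> (\<lambda>(S, f). (\<lambda>x. (x, f x)) ` S) ` ?D" by force
  qed
  then have "card (partial_injections X N l) \<le> card ?D"
    using finS fin by (intro surj_card_le) auto
  also have "\<dots> = (\<Sum>S | S \<subseteq> X \<and> card S = l. card (inj_sections S N))"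
    using finS fin by (intro card_SigmaI) auto
  finally show ?thesis .
qed

text \<open>The common core of (i) and (ii). The exponential factor depends on \<open>S\<close> only
  through its size and comes out of the sum over \<open>S\<close>.\<close>

lemma card_partial_injections_le:
  fixes X :: "'a set" and N :: "'a \<Rightarrow> 'b set"
  assumes "finite X" "X \<noteq> {}" "finite Y" "l \<le> card Y" "1 \<le> \<delta>"
    and N: "\<And>x. x \<in> X \<Longrightarrow> N x \<subseteq> Y" "\<And>x. x \<in> X \<Longrightarrow> \<delta> \<le> card (N x)"
  defines "\<alpha> \<equiv> real l / real (card Y)"
  shows "real (card (partial_injections X N l))
    \<le> real (\<Sum>S | S \<subseteq> X \<and> card S = l. \<Prod>x\<in>S. card (N x)) *
      2 powr (real (card Y) * (bin_entropy \<alpha> + \<alpha> * log 2 (\<alpha> / exp 1) + log_quot (real \<delta>)))"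
    (is "_ \<le> _ * ?c")
proof -
  have \<delta>: "\<delta> \<le> card Y"
    using assms(2,3) N card_mono by (metis ex_in_conv le_trans)
  have "real (card (partial_injections X N l))
      \<le> real (\<Sum>S | S \<subseteq> X \<and> card S = l. card (inj_sections S N))"
    using assms finite_subset by (intro of_nat_mono card_partial_injections_le_sum) blast+
  also have "\<dots> = (\<Sum>S | S \<subseteq> X \<and> card S = l. real (card (inj_sections S N)))" by simp
  also have "\<dots> \<le> (\<Sum>S | S \<subseteq> X \<and> card S = l. (\<Prod>x\<in>S. real (card (N x))) * ?c)"
  proof (rule sum_mono)
    fix S assume "S \<in> {S. S \<subseteq> X \<and> card S = l}"
    then have S: "S \<subseteq> X" "card S = l" by auto
    show "real (card (inj_sections S N)) \<le> (\<Prod>x\<in>S. real (card (N x))) * ?c"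
      unfolding \<alpha>_def S(2)[symmetric]
      using S assms(1,3-7) \<delta> finite_subset
      by (intro card_inj_sections_le) (use S in blast)+
  qed
  also have "\<dots> = real (\<Sum>S | S \<subseteq> X \<and> card S = l. \<Prod>x\<in>S. card (N x)) * ?c"
    by (simp add: sum_distrib_right)
  finally show ?thesis .
qed

subsection \<open>Unions of two matchings\<close>

text \<open>Under a \<open>proper\<close> colouring each edge yields exactly one pair, starting at
  its endpoint of colour \<open>True\<close>.\<close>

definition oriented :: "('a \<Rightarrow> bool) \<Rightarrow> 'a set set \<Rightarrow> ('a \<times> 'a) set" where
  "oriented c M = {(u, v). {u, v} \<in> M \<and> c u}"

definition proper :: "('a \<Rightarrow> bool) \<Rightarrow> 'a set set \<Rightarrow> bool" where
  "proper c M \<longleftrightarrow> (\<forall>u v. {u, v} \<in> M \<longrightarrow> c u \<noteq> c v)"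

lemma image_oriented:
  assumes "proper c M" "\<And>e. e \<in> M \<Longrightarrow> card e = 2"
  shows "(\<lambda>(u, v). {u, v}) ` oriented c M = M"
proof
  show "M \<subseteq> (\<lambda>(u, v). {u, v}) ` oriented c M"
  proof
    fix e assume e: "e \<in> M"
    then obtain u v where uv: "e = {u, v}" using assms(2) by (metis card_2_iff)
    then have "c u \<or> c v" using e assms(1) by (auto simp: proper_def)
    then have "(u, v) \<in> oriented c M \<or> (v, u) \<in> oriented c M"
      using e uv by (auto simp: oriented_def insert_commute)
    then show "e \<in> (\<lambda>(u, v). {u, v}) ` oriented c M" using uv by force
  qed
qed (auto simp: oriented_def)

lemma card_oriented:
  assumes "proper c M" "\<And>e. e \<in> M \<Longrightarrow> card e = 2"
  shows "card (oriented c M) = card M"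
proof -
  have "inj_on (\<lambda>(u, v). {u, v}) (oriented c M)"
    using assms(1) by (auto simp: inj_on_def oriented_def proper_def doubleton_eq_iff)
  then have "card ((\<lambda>(u, v). {u, v}) ` oriented c M) = card (oriented c M)" by (rule card_image)
  then show ?thesis using image_oriented[OF assms] by simp
qed

lemma matching_partner_unique:
  assumes "pairwise disjnt M" "{u, v} \<in> M" "{u, w} \<in> M"
  shows "v = w"
  using assms by (metis disjnt_iff doubleton_eq_iff insertI1 pairwiseD)

lemma proper_subset: "proper c U \<Longrightarrow> M \<subseteq> U \<Longrightarrow> proper c M"
  by (auto simp: proper_def)

lemma proper_Not: "proper (\<lambda>v. \<not> c v) M \<longleftrightarrow> proper c M"
  by (auto simp: proper_def)

text \<open>Choose one endpoint of every edge and colour the chosen vertices; by disjointness no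
  other edge can choose the remaining endpoint.\<close>

lemma ex_proper_matching:
  assumes "pairwise disjnt M" "\<And>e. e \<in> M \<Longrightarrow> card e = 2"
  shows "\<exists>c. proper c M"
proof -
  define g where "g = (\<lambda>e::'a set. SOME x. x \<in> e)"
  have "(u \<in> g ` M) \<noteq> (v \<in> g ` M)" if e: "{u, v} \<in> M" for u v
  proof -
    have "u \<noteq> v" using assms(2)[OF e] by auto
    have g: "g f \<in> f" if "f \<in> M" for f
      using assms(2)[OF that] unfolding g_def by (metis card_2_iff insertI1 someI)
    have *: "x \<in> g ` M \<longleftrightarrow> g {u, v} = x" if "x \<in> {u, v}" for x
    proof
      assume "x \<in> g ` M"
      then obtain f where f: "f \<in> M" "x = g f" by blast
      then have "\<not> disjnt f {u, v}" using g that by (metis disjnt_iff)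
      then have "f = {u, v}" using assms(1) e f by (metis pairwiseD)
      with f show "g {u, v} = x" by simp
    qed (use e in auto)
    show ?thesis using *[of u] *[of v] g[OF e] \<open>u \<noteq> v\<close> by auto
  qed
  then show ?thesis
    unfolding proper_def by (intro exI[of _ "\<lambda>x. x \<in> g ` M"]) simp
qed

text \<open>
  Induction on \<open>M\<close>: contract the alternating path \<open>w - u - v - z\<close> around an edge \<open>{u, v}\<close> of \<open>M\<close> to
  the single edge \<open>{w, z}\<close> of \<open>M'\<close>.
\<close>

lemma ex_proper_Un_matchings:
  assumes "finite M" "pairwise disjnt M" "pairwise disjnt M'"
    "\<And>e. e \<in> M \<union> M' \<Longrightarrow> card e = 2"
  shows "\<exists>c. proper c (M \<union> M')"
  using assms
proof (induction M arbitrary: M')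
  case empty
  then show ?case using ex_proper_matching by auto
next
  case (insert e M)
  obtain u v where e: "e = {u, v}" and uv: "u \<noteq> v"
    using insert.prems(3) by (metis UnI1 card_2_iff insertI1)
  define R where "R = {f \<in> M'. u \<notin> f \<and> v \<notin> f}"
  have disjM: "pairwise disjnt M" using insert.prems(1) by (simp add: pairwise_insert)
  have disjR: "pairwise disjnt R"
    using insert.prems(2) by (rule pairwise_subset) (auto simp: R_def)
  have disj: "u \<notin> f" "v \<notin> f" if "f \<in> M" for f
    using insert.prems(1) insert.hyps(2) that unfolding e
    by (auto simp: pairwise_insert disjnt_iff)
  have partner: "x = y" if "{w, x} \<in> M'" "{w, y} \<in> M'" for w x y
    using matching_partner_unique[OF insert.prems(2) that] .
  have nonloop: "x \<noteq> y" if "{x, y} \<in> M'" for x y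
    using insert.prems(3)[of "{x, y}"] that by auto
  \<comment> \<open>The path can be closed up only if the outer neighbours of \<open>u\<close> and
    \<open>v\<close> get different colours. The contracted edge \<open>{w, z}\<close> enforces this
    when both exist; otherwise the condition is vacuous.\<close>
  obtain c where c: "proper c (M \<union> R)"
    and c2: "\<And>w z. {u, w} \<in> M' \<Longrightarrow> {v, z} \<in> M' \<Longrightarrow> w \<noteq> v \<Longrightarrow> c w \<noteq> c z"
  proof (cases "\<exists>w z. {u, w} \<in> M' \<and> {v, z} \<in> M' \<and> w \<noteq> v")
    case True
    then obtain w z where wz: "{u, w} \<in> M'" "{v, z} \<in> M'" "w \<noteq> v" by blast
    have "w \<noteq> z" using wz partner[of w u v] uv by (auto simp: insert_commute)
    have "pairwise disjnt (insert {w, z} R)"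
    proof -
      have "w \<notin> f \<and> z \<notin> f" if "f \<in> R" for f
      proof -
        have "f \<in> M'" "f \<noteq> {u, w}" "f \<noteq> {v, z}" using that by (auto simp: R_def)
        then have "disjnt f {u, w}" "disjnt f {v, z}"
          using pairwiseD[OF insert.prems(2)] wz by blast+
        then show ?thesis by (auto simp: disjnt_iff)
      qed
      with disjR show ?thesis by (auto simp: pairwise_insert disjnt_iff)
    qed
    moreover have "card f = 2" if "f \<in> M \<union> insert {w, z} R" for f
      using that insert.prems(3) \<open>w \<noteq> z\<close> by (auto simp: R_def)
    ultimately obtain c where c: "proper c (M \<union> insert {w, z} R)"
      using insert.IH[OF disjM] by blast
    show ?thesis
    proof (rule that)
      show "proper c (M \<union> R)" using c by (rule proper_subset) auto
      have "c w \<noteq> c z" using c by (auto simp: proper_def)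
      then show "c w' \<noteq> c z'" if "{u, w'} \<in> M'" "{v, z'} \<in> M'" for w' z'
        using partner[OF wz(1) that(1)] partner[OF wz(2) that(2)] by simp
    qed
  next
    case False
    moreover obtain c where "proper c (M \<union> R)"
      using insert.IH[OF disjM disjR] insert.prems(3) by (auto simp: R_def)
    ultimately show ?thesis using that by blast
  qed
  \<comment> \<open>\<open>p\<close> is the colour for \<open>u\<close>, and \<open>v\<close> gets
    the opposite one. An outer neighbour of \<open>u\<close> or of \<open>v\<close> determines
    \<open>p\<close>, and the two demands agree by \<open>c2\<close>.\<close>
  obtain p where p: "\<And>w. {u, w} \<in> M' \<Longrightarrow> w \<noteq> v \<Longrightarrow> p \<noteq> c w"
    "\<And>z. {v, z} \<in> M' \<Longrightarrow> z \<noteq> u \<Longrightarrow> p = c z"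
  proof (cases "\<exists>w. {u, w} \<in> M' \<and> w \<noteq> v")
    case True
    then obtain w where w: "{u, w} \<in> M'" "w \<noteq> v" by blast
    show ?thesis using that[of "\<not> c w"] c2[OF w(1) _ w(2)] partner[OF w(1)] by blast
  next
    case False
    show ?thesis
    proof (cases "\<exists>z. {v, z} \<in> M'")
      case True
      then obtain z where "{v, z} \<in> M'" by blast
      then show ?thesis using that[of "c z"] False partner by blast
    qed (use that False in blast)
  qed
  have "proper (c(u := p, v := \<not> p)) (insert e M \<union> M')"
    unfolding proper_def
  proof (intro allI impI)
    fix x y assume xy: "{x, y} \<in> insert e M \<union> M'"
    let ?c = "c(u := p, v := \<not> p)"
    consider "{x, y} = {u, v}" | "{x, y} \<in> M" | "{x, y} \<in> R"
      | "{x, y} \<in> M'" "{x, y} \<noteq> {u, v}" "x = u \<or> x = v \<or> y = u \<or> y = v"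
      using xy e by (auto simp: R_def)
    then show "?c x \<noteq> ?c y"
    proof cases
      case 1
      then show ?thesis using uv by (auto simp: doubleton_eq_iff)
    next
      case 2
      then show ?thesis using c disj[OF 2] by (auto simp: proper_def)
    next
      case 3
      then show ?thesis using c by (auto simp: proper_def R_def)
    next
      case 4
      have yx: "{y, x} \<in> M'" using 4 by (simp add: insert_commute)
      consider "x = u" | "x = v" | "y = u" | "y = v" using 4 by blast
      then show ?thesis
      proof cases
        case 1
        with 4 nonloop have "y \<noteq> u" "y \<noteq> v" by auto
        with 1 4 uv p(1)[of y] show ?thesis by simp
      next
        case 2
        with 4 nonloop have "y \<noteq> u" "y \<noteq> v" by auto
        with 2 4 uv p(2)[of y] show ?thesis by simp
      next
        case 3
        with 4 nonloop have "x \<noteq> u" "x \<noteq> v" by auto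
        with 3 yx uv p(1)[of x] show ?thesis by simp
      next
        case 4
        with \<open>{x, y} \<in> M'\<close> \<open>{x, y} \<noteq> {u, v}\<close> nonloop have "x \<noteq> u" "x \<noteq> v" by auto
        with 4 yx uv p(2)[of x] show ?thesis by simp
      qed
    qed
  qed
  then show ?case by blast
qed

subsection \<open>Matchings as partial injections\<close>

lemma elog2_le:
  assumes "real a \<le> real b * 2 powr c"
  shows "elog2 a \<le> elog2 b + ereal c"
proof (cases "a = 0")
  case False
  then have b: "0 < b" using assms by (cases "b = 0") auto
  have "log 2 (real a) \<le> log 2 (real b * 2 powr c)" using False assms by simp
  also have "\<dots> = log 2 (real b) + c" using b by (simp add: log_mult)
  finally show ?thesis using False b by (simp add: elog2_def)
qed (simp add: elog2_def)

text \<open>Part (ii) bounds the number of pairs of matchings, hence the square. If \<open>a\<close>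
  is positive, the hypothesis forces \<open>b\<close> to be positive, so both logarithms are
  finite.\<close>

lemma elog2_le_half:
  assumes "real (a\<^sup>2) \<le> real b * 2 powr c"
  shows "elog2 a \<le> ereal (1 / 2) * elog2 b + ereal (c / 2)"
proof (cases "a = 0")
  case False
  then have b: "0 < b" using assms by (cases "b = 0") auto
  have "2 * log 2 (real a) = log 2 (real (a\<^sup>2))" using False by (simp add: log_nat_power)
  also have "\<dots> \<le> log 2 (real b * 2 powr c)"
    using False assms b by (subst log_le_cancel_iff) auto
  also have "\<dots> = log 2 (real b) + c" using b by (simp add: log_mult)
  finally show ?thesis using False b by (simp add: elog2_def)
qed (simp add: elog2_def)

lemma degree_eq_card_neighbours:
  assumes "fin_simple_graph V E"
  shows "degree E x = card {y. {x, y} \<in> E}"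
proof -
  have "{e \<in> E. x \<in> e} = (\<lambda>y. {x, y}) ` {y. {x, y} \<in> E}"
  proof
    show "{e \<in> E. x \<in> e} \<subseteq> (\<lambda>y. {x, y}) ` {y. {x, y} \<in> E}"
    proof clarify
      fix e assume "e \<in> E" "x \<in> e"
      moreover from this obtain y where "e = {x, y}"
        using fin_simple_graph.edges[OF assms] by (metis card_2_iff insertE insert_commute singletonD)
      ultimately show "e \<in> (\<lambda>y. {x, y}) ` {y. {x, y} \<in> E}" by auto
    qed
  qed auto
  moreover have "inj_on (\<lambda>y. {x, y}) {y. {x, y} \<in> E}"
    by (auto simp: inj_on_def doubleton_eq_iff)
  ultimately show ?thesis by (simp add: degree_def card_image)
qed

lemma finite_edges: "fin_simple_graph V E \<Longrightarrow> finite E"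
  using fin_simple_graph.edges[of V E] fin_simple_graph.finite_vertices[of V E]
  by (meson PowI finite_Pow_iff finite_subset subsetI)

lemma min_degree_bounds:
  assumes "fin_simple_graph V E" "no_isolated V E" "X \<subseteq> V" "X \<noteq> {}"
  shows "1 \<le> min_degree E X" "\<And>x. x \<in> X \<Longrightarrow> min_degree E X \<le> degree E x"
proof -
  have finX: "finite X"
    using assms fin_simple_graph.finite_vertices finite_subset by blast
  then show "\<And>x. x \<in> X \<Longrightarrow> min_degree E X \<le> degree E x" by (simp add: min_degree_def)
  have "1 \<le> degree E x" if "x \<in> X" for x
    using that assms finite_edges[OF assms(1)]
    by (auto simp: degree_def no_isolated_def Suc_le_eq card_gt_0_iff)
  then show "1 \<le> min_degree E X"
    using finX assms(4) by (simp add: min_degree_def)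
qed

lemma inj_on_oriented:
  assumes "pairwise disjnt M"
  shows "inj_on fst (oriented c M)" "inj_on snd (oriented c M)"
  using matching_partner_unique[OF assms]
  by (auto simp: inj_on_def oriented_def insert_commute)

text \<open>Membership in \<open>X\<close> is a proper colouring, so every edge is directed from
  \<open>X\<close> to \<open>Y\<close>; forgetting directions recovers the matching.\<close>

lemma num_matchings_bipartite_le:
  assumes "fin_simple_graph V E" "bipartition V E X Y"
  shows "num_matchings E l \<le> card (partial_injections X (\<lambda>x. {y. {x, y} \<in> E}) l)"
  unfolding num_matchings_def
proof (rule card_inj_on_le[where f = "oriented (\<lambda>x. x \<in> X)"])
  have c2: "card e = 2" if "e \<in> E" for e
    using fin_simple_graph.edges[OF assms(1) that] by simp
  have "finite V" using fin_simple_graph.finite_vertices[OF assms(1)] .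
  have XY: "(x \<in> X) \<noteq> (y \<in> X)" if "{x, y} \<in> E" for x y
    using assms(2) that unfolding bipartition_def by (metis doubleton_eq_iff disjoint_iff)
  have pE: "proper (\<lambda>x. x \<in> X) M" if "M \<subseteq> E" for M
    using XY that by (auto simp: proper_def)
  show "inj_on (oriented (\<lambda>x. x \<in> X)) (matchings E l)"
  proof (rule inj_onI)
    fix M M' assume "M \<in> matchings E l" "M' \<in> matchings E l"
      and eq: "oriented (\<lambda>x. x \<in> X) M = oriented (\<lambda>x. x \<in> X) M'"
    then have "M \<subseteq> E" "M' \<subseteq> E" by (auto simp: matchings_def)
    then show "M = M'"
      using image_oriented[OF pE, of M] image_oriented[OF pE, of M'] c2 eq by (metis subsetD)
  qed
  show "oriented (\<lambda>x. x \<in> X) ` matchings E l \<subseteq> partial_injections X (\<lambda>x. {y. {x, y} \<in> E}) l"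
  proof (rule image_subsetI)
    fix M assume "M \<in> matchings E l"
    then have M: "M \<subseteq> E" "card M = l" "pairwise disjnt M" by (auto simp: matchings_def)
    have "card (oriented (\<lambda>x. x \<in> X) M) = l"
      using card_oriented[OF pE[OF M(1)]] c2 M by auto
    then show "oriented (\<lambda>x. x \<in> X) M \<in> partial_injections X (\<lambda>x. {y. {x, y} \<in> E}) l"
      using inj_on_oriented[OF M(3)] M(1)
      by (auto simp: partial_injections_def oriented_def)
  qed
  have "finite X" using assms(2) \<open>finite V\<close> by (auto simp: bipartition_def)
  moreover have "{y. {x, y} \<in> E} \<subseteq> V" for x
    using fin_simple_graph.edges[OF assms(1)] by blast
  ultimately show "finite (partial_injections X (\<lambda>x. {y. {x, y} \<in> E}) l)"
    using \<open>finite V\<close> finite_subset by (intro finite_partial_injections) blast+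
qed

text \<open>The image of a pair of matchings determines their union by forgetting directions, hence
  the colouring, and the colour of its first vertex tells which matching a directed edge came
  from.\<close>

lemma num_matchings_square_le:
  fixes V :: "'a set" and E :: "'a set set"
  assumes "fin_simple_graph V E"
  shows "(num_matchings E l)\<^sup>2 \<le> card (partial_injections V (\<lambda>x. {y. {x, y} \<in> E}) (2 * l))"
proof -
  define c where "c = (\<lambda>U::'a set set. SOME c. proper c U)"
  define f where "f = (\<lambda>(M, M'). oriented (c (M \<union> M')) M \<union> oriented (\<lambda>v. \<not> c (M \<union> M') v) M')"
  have c2: "card e = 2" if "e \<in> E" for e
    using fin_simple_graph.edges[OF assms that] by simp
  have finE: "finite E" using finite_edges[OF assms] .
  have finV: "finite V" using fin_simple_graph.finite_vertices[OF assms] .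
  have sub: "M \<subseteq> E" "card M = l" "pairwise disjnt M" "finite M" "e \<in> M \<Longrightarrow> card e = 2"
    if "M \<in> matchings E l" for M e
    using that c2 finE finite_subset by (auto simp: matchings_def)
  have c: "proper (c (M \<union> M')) M" "proper (c (M \<union> M')) M'" "proper (\<lambda>v. \<not> c (M \<union> M') v) M'"
    if M: "M \<in> matchings E l" "M' \<in> matchings E l" for M M'
  proof -
    have "\<exists>c. proper c (M \<union> M')"
      using sub[OF M(1)] sub[OF M(2)] by (intro ex_proper_Un_matchings) auto
    then have "proper (c (M \<union> M')) (M \<union> M')" unfolding c_def by (rule someI_ex)
    then show "proper (c (M \<union> M')) M" "proper (c (M \<union> M')) M'" "proper (\<lambda>v. \<not> c (M \<union> M') v) M'"
      by (auto simp: proper_Not intro: proper_subset)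
  qed
  have image_f: "(\<lambda>(u, v). {u, v}) ` f (M, M') = M \<union> M'"
    if M: "M \<in> matchings E l" "M' \<in> matchings E l" for M M'
    unfolding f_def prod.case image_Un
    using image_oriented[OF c(1)[OF M]] image_oriented[OF c(3)[OF M]] sub(5)[OF M(1)] sub(5)[OF M(2)]
    by simp
  have fst_f: "oriented (c (M \<union> M')) M = {a \<in> f (M, M'). c (M \<union> M') (fst a)}"
    and snd_f: "oriented (\<lambda>v. \<not> c (M \<union> M') v) M' = {a \<in> f (M, M'). \<not> c (M \<union> M') (fst a)}" for M M'
    by (auto simp: f_def oriented_def)
  have "card (matchings E l \<times> matchings E l)
      \<le> card (partial_injections V (\<lambda>x. {y. {x, y} \<in> E}) (2 * l))"
  proof (rule card_inj_on_le[where f = f])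
    show "inj_on f (matchings E l \<times> matchings E l)"
    proof (rule inj_onI, clarify)
      fix M1 M1' M2 M2'
      assume M1: "M1 \<in> matchings E l" "M1' \<in> matchings E l"
        and M2: "M2 \<in> matchings E l" "M2' \<in> matchings E l"
        and eq: "f (M1, M1') = f (M2, M2')"
      have U: "M1 \<union> M1' = M2 \<union> M2'" using image_f[OF M1] image_f[OF M2] eq by simp
      have "oriented (c (M1 \<union> M1')) M1 = oriented (c (M2 \<union> M2')) M2"
        unfolding fst_f using U eq by simp
      moreover have "oriented (\<lambda>v. \<not> c (M1 \<union> M1') v) M1' = oriented (\<lambda>v. \<not> c (M2 \<union> M2') v) M2'"
        unfolding snd_f using U eq by simp
      ultimately show "M1 = M2 \<and> M1' = M2'"
        using image_oriented[OF c(1)[OF M1]] image_oriented[OF c(3)[OF M1]]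
          image_oriented[OF c(1)[OF M2]] image_oriented[OF c(3)[OF M2]]
          sub(5)[OF M1(1)] sub(5)[OF M1(2)] sub(5)[OF M2(1)] sub(5)[OF M2(2)]
        by simp
    qed
    show "f ` (matchings E l \<times> matchings E l)
      \<subseteq> partial_injections V (\<lambda>x. {y. {x, y} \<in> E}) (2 * l)"
    proof (rule image_subsetI, clarify)
      fix M M' assume M: "M \<in> matchings E l" "M' \<in> matchings E l"
      let ?A = "oriented (c (M \<union> M')) M" and ?B = "oriented (\<lambda>v. \<not> c (M \<union> M') v) M'"
      \<comment> \<open>An edge common to both matchings occurs once in each direction, so the size
        is exactly 2l.\<close>
      have "?A \<inter> ?B = {}" by (auto simp: oriented_def)
      moreover have cards: "card ?A = l" "card ?B = l"
        using card_oriented[OF c(1)[OF M]] card_oriented[OF c(3)[OF M]] sub[OF M(1)] sub[OF M(2)]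
        by auto
      moreover have "?A \<union> ?B \<subseteq> V \<times> V"
        using sub(1)[OF M(1)] sub(1)[OF M(2)] fin_simple_graph.edges[OF assms]
        by (force simp: oriented_def)
      then have "finite ?A" "finite ?B" using finV by (auto intro: finite_subset)
      ultimately have "card (f (M, M')) = 2 * l" by (simp add: f_def card_Un_disjoint)
      moreover have "inj_on fst (f (M, M'))"
      proof -
        have "fst ` ?A \<inter> fst ` ?B = {}" by (auto simp: oriented_def)
        then show ?thesis
          unfolding f_def prod.case inj_on_Un
          by (intro conjI inj_on_oriented(1)[OF sub(3)] M) blast
      qed
      moreover have "inj_on snd (f (M, M'))"
      proof -
        \<comment> \<open>By properness, pairs of \<open>?A\<close> end in colour
          \<open>False\<close> and pairs of \<open>?B\<close> in colour \<open>True\<close>.\<close>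
        have "snd ` ?A \<inter> snd ` ?B = {}"
          using c(1,2)[OF M] by (auto simp: oriented_def proper_def)
        then show ?thesis
          unfolding f_def prod.case inj_on_Un
          by (intro conjI inj_on_oriented(2)[OF sub(3)] M) blast
      qed
      moreover have "f (M, M') \<subseteq> (SIGMA x : V. {y. {x, y} \<in> E})"
        using \<open>?A \<union> ?B \<subseteq> V \<times> V\<close> sub(1)[OF M(1)] sub(1)[OF M(2)]
        by (auto simp: f_def oriented_def)
      ultimately show "f (M, M') \<in> partial_injections V (\<lambda>x. {y. {x, y} \<in> E}) (2 * l)"
        by (simp add: partial_injections_def)
    qed
    have "{y. {x, y} \<in> E} \<subseteq> V" for x
      using fin_simple_graph.edges[OF assms] by blast
    then show "finite (partial_injections V (\<lambda>x. {y. {x, y} \<in> E}) (2 * l))"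
      using finV finite_subset by (intro finite_partial_injections) blast+
  qed
  then show ?thesis by (simp add: num_matchings_def power2_eq_square card_cartesian_product)
qed

theorem theorem1p3:
  fixes V :: "'a set" and E :: "'a set set"
  assumes "fin_simple_graph V E" and "V \<noteq> {}" and "no_isolated V E"
  shows
    "(\<forall>X Y l. bipartition V E X Y \<longrightarrow> l \<le> min (card X) (card Y) \<longrightarrow>
        (let \<delta> = real (min_degree E X); \<alpha> = real l / real (card Y) in
          elog2 (num_matchings E l) \<le>
            elog2 (deg_sum E l X) +
            ereal (real (card Y) *
              (bin_entropy \<alpha> + \<alpha> * log 2 (\<alpha> / exp 1) + log_quot \<delta>))))
   \<and> (\<forall>l. real l \<le> real (card V) / 2 \<longrightarrow>
        (let \<delta> = real (min_degree E V); \<alpha> = 2 * real l / real (card V) in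
          elog2 (num_matchings E l) \<le>
            ereal (1 / 2) * elog2 (deg_sum E (2 * l) V) +
            ereal (real (card V) / 2 *
              (bin_entropy \<alpha> + \<alpha> * log 2 (\<alpha> / exp 1) + log_quot \<delta>))))"
proof -
  let ?N = "\<lambda>x. {y. {x, y} \<in> E}"
  have finV: "finite V" using fin_simple_graph.finite_vertices[OF assms(1)] .
  have deg: "degree E x = card (?N x)" for x by (rule degree_eq_card_neighbours[OF assms(1)])
  have bip: "elog2 (num_matchings E l) \<le> elog2 (deg_sum E l X) + ereal (real (card Y) *
      (bin_entropy (real l / real (card Y)) + real l / real (card Y) * log 2 (real l / real (card Y) / exp 1)
        + log_quot (real (min_degree E X))))"
    if XY: "bipartition V E X Y" and l: "l \<le> min (card X) (card Y)" for X Y l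
  proof (rule elog2_le)
    have "X \<subseteq> V" "Y \<subseteq> V" using XY by (auto simp: bipartition_def)
    then have fin: "finite X" "finite Y" using finV finite_subset by auto
    \<comment> \<open>Some vertex exists and lies on an edge, which has an end in \<open>X\<close>;
      thus the minimum degree over \<open>X\<close> is taken over a nonempty set.\<close>
    have "X \<noteq> {}"
      using assms(2,3) XY unfolding no_isolated_def bipartition_def by blast
    note \<delta> = min_degree_bounds[OF assms(1,3) \<open>X \<subseteq> V\<close> \<open>X \<noteq> {}\<close>]
    have N: "?N x \<subseteq> Y" if "x \<in> X" for x
    proof
      fix y assume "y \<in> ?N x"
      then obtain x' y' where "x' \<in> X" "y' \<in> Y" "{x, y} = {x', y'}"
        using XY by (auto simp: bipartition_def)
      then show "y \<in> Y" using that XY by (auto simp: bipartition_def doubleton_eq_iff)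
    qed
    have "real (num_matchings E l) \<le> real (card (partial_injections X ?N l))"
      using num_matchings_bipartite_le[OF assms(1) XY] by simp
    also have "\<dots> \<le> real (deg_sum E l X) * 2 powr (real (card Y) *
      (bin_entropy (real l / real (card Y)) + real l / real (card Y) * log 2 (real l / real (card Y) / exp 1)
        + log_quot (real (min_degree E X))))"
      unfolding deg_sum_def deg
      using \<delta> l unfolding deg
      by (intro card_partial_injections_le fin \<open>X \<noteq> {}\<close> N) auto
    finally show "real (num_matchings E l) \<le> \<dots>" .
  qed
  \<comment> \<open>In the double cover both sides are \<open>V\<close> and 2l plays the role of l;
    halving the logarithm of the squared count produces the factors 1/2.\<close>
  have gen: "elog2 (num_matchings E l) \<le> ereal (1 / 2) * elog2 (deg_sum E (2 * l) V) +
      ereal (real (card V) * (bin_entropy (real (2 * l) / real (card V)) +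
        real (2 * l) / real (card V) * log 2 (real (2 * l) / real (card V) / exp 1)
        + log_quot (real (min_degree E V))) / 2)"
    if l: "2 * l \<le> card V" for l
  proof (rule elog2_le_half)
    note \<delta> = min_degree_bounds[OF assms(1,3) order_refl assms(2)]
    have N: "?N x \<subseteq> V" for x using fin_simple_graph.edges[OF assms(1)] by blast
    have "real ((num_matchings E l)\<^sup>2) \<le> real (card (partial_injections V ?N (2 * l)))"
      using num_matchings_square_le[OF assms(1)] by (rule of_nat_mono)
    also have "\<dots> \<le> real (deg_sum E (2 * l) V) * 2 powr (real (card V) *
      (bin_entropy (real (2 * l) / real (card V)) +
        real (2 * l) / real (card V) * log 2 (real (2 * l) / real (card V) / exp 1)
        + log_quot (real (min_degree E V))))"
      unfolding deg_sum_def deg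
      using \<delta> unfolding deg
      by (intro card_partial_injections_le finV assms(2) N l) auto
    finally show "real ((num_matchings E l)\<^sup>2) \<le> \<dots>" .
  qed
  show ?thesis
  proof (intro conjI allI impI)
    fix l assume "real l \<le> real (card V) / 2"
    then have "2 * l \<le> card V" by linarith
    from gen[OF this] show "let \<delta> = real (min_degree E V); \<alpha> = 2 * real l / real (card V) in
          elog2 (num_matchings E l) \<le>
            ereal (1 / 2) * elog2 (deg_sum E (2 * l) V) +
            ereal (real (card V) / 2 *
              (bin_entropy \<alpha> + \<alpha> * log 2 (\<alpha> / exp 1) + log_quot \<delta>))"
      by (simp add: Let_def)
  qed (use bip in \<open>simp add: Let_def\<close>)
qed

end
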